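(* Let $G$ be a cograph. Then for every eigenvalue $\lambda\notin\{0,-1\}$ of the adjacency matrix $A(G)$, the multiplicity of $\lambda$ is at most the Dilworth number $\nabla(G)$. Moreover, there is an infinite family of cographs $G$ each of which has an eigenvalue $\lambda\notin\{0,-1\}$ whose multiplicity equals $\nabla(G)$.
   Context: All graphs are finite, simple and undirected; eigenvalues of a graph are those of its $0/1$ adjacency matrix. A cograph is a graph containing no induced path on 4 vertices. For a vertex $v$, $N_G(v)$ is its open neighborhood and $N_G[v]=N_G(v)\cup\{v\}$ its closed neighborhood. The vicinal preorder on $V(G)$ is defined by $u\prec v$ if and only if $N_G(u)\subseteq N_G[v]$. A chain is a set of vertices pairwise comparable under $\prec$. The Dilworth number $\nabla(G)$ is the minimum number of chains needed to cover $V(G)$ (equivalently, the maximum size of an antichain with respect to $\prec$). *)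

theory Defs
  imports
    "Graph_Theory.Pair_Digraph"
    "Graph_Theory.Digraph_Isomorphism"
    "Jordan_Normal_Form.Char_Poly"
begin

text \<open>
  A finite simple undirected graph is a \<^locale>\<open>pair_graph\<close>: a finite, loop-free,
  symmetric arc relation, where an edge between \<open>u\<close> and \<open>v\<close> is the pair of arcs
  \<open>(u,v)\<close>, \<open>(v,u)\<close>.
\<close>

definition has_induced_P4 :: "'a pair_pre_digraph \<Rightarrow> bool" where
  "has_induced_P4 G \<longleftrightarrow>
     (\<exists>a b c d. {a, b, c, d} \<subseteq> pverts G \<and> distinct [a, b, c, d] \<and>
        (a, b) \<in> parcs G \<and> (b, c) \<in> parcs G \<and> (c, d) \<in> parcs G \<and>
        (a, c) \<notin> parcs G \<and> (a, d) \<notin> parcs G \<and> (b, d) \<notin> parcs G)"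

definition cograph :: "'a pair_pre_digraph \<Rightarrow> bool" where
  "cograph G \<longleftrightarrow> pair_graph G \<and> \<not> has_induced_P4 G"

definition open_nbhd :: "'a pair_pre_digraph \<Rightarrow> 'a \<Rightarrow> 'a set" where
  "open_nbhd G v = {w \<in> pverts G. (v, w) \<in> parcs G}"

definition closed_nbhd :: "'a pair_pre_digraph \<Rightarrow> 'a \<Rightarrow> 'a set" where
  "closed_nbhd G v = open_nbhd G v \<union> {v}"

definition vicinal_le :: "'a pair_pre_digraph \<Rightarrow> 'a \<Rightarrow> 'a \<Rightarrow> bool" where
  "vicinal_le G u v \<longleftrightarrow> open_nbhd G u \<subseteq> closed_nbhd G v"

definition vicinal_chain :: "'a pair_pre_digraph \<Rightarrow> 'a set \<Rightarrow> bool" where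
  "vicinal_chain G C \<longleftrightarrow>
     C \<subseteq> pverts G \<and> (\<forall>u\<in>C. \<forall>v\<in>C. vicinal_le G u v \<or> vicinal_le G v u)"

definition dilworth_number :: "'a pair_pre_digraph \<Rightarrow> nat" where
  "dilworth_number G =
     (LEAST k. \<exists>\<C>. finite \<C> \<and> card \<C> = k \<and> (\<forall>C\<in>\<C>. vicinal_chain G C) \<and> \<Union>\<C> = pverts G)"

definition vertex_ordering :: "'a pair_pre_digraph \<Rightarrow> 'a list \<Rightarrow> bool" where
  "vertex_ordering G vs \<longleftrightarrow> distinct vs \<and> set vs = pverts G"

text \<open>
  Rows and columns are indexed by positions in an ordering \<open>vs\<close> of the vertices. Different
  orderings give matrices that are conjugate by a permutation, hence have the same spectrum.
  The entries are real: adjacency matrices are symmetric, so all eigenvalues are real.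
\<close>

definition adjacency_matrix :: "'a pair_pre_digraph \<Rightarrow> 'a list \<Rightarrow> real mat" where
  "adjacency_matrix G vs =
     mat (length vs) (length vs) (\<lambda>(i, j). if (vs ! i, vs ! j) \<in> parcs G then 1 else 0)"

definition eigenvalue_multiplicity :: "real mat \<Rightarrow> real \<Rightarrow> nat" where
  "eigenvalue_multiplicity A l = Polynomial.order l (char_poly A)"

end

theory Submission
  imports Defs
    "Jordan_Normal_Form.Jordan_Normal_Form_Existence"
    "Jordan_Normal_Form.Jordan_Normal_Form_Uniqueness"
begin

text \<open>
  Fix \<open>l \<notin> {0, -1}\<close> and consider the space \<open>W\<close> of all vectors \<open>x\<close> with \<open>Ax - lx\<close> a constant vector;
  it contains the eigenspace of \<open>l\<close>. Since \<open>A + A' = J - I\<close> for the adjacency matrix \<open>A'\<close> of the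
  complement, passing to the complement and from \<open>l\<close> to \<open>-1 - l\<close> (again not in \<open>{0, -1}\<close>) leaves
  \<open>W\<close> unchanged; it also leaves the vicinal chains unchanged. A cograph with at least two vertices
  or its complement is disconnected, so by induction \<open>dim W\<close> is at most the size of any chain
  cover: in a disjoint union without isolated vertices each chain lies on one side and \<open>W\<close> embeds
  into the product of the two smaller spaces, and forgetting the entry at an isolated vertex is
  injective on \<open>W\<close> because \<open>l \<noteq> 0\<close>. As \<open>A\<close> is real symmetric, the algebraic multiplicity of \<open>l\<close> is the dimension of
  its eigenspace. Equality holds for complete graphs on \<open>n \<ge> 2\<close> vertices, with \<open>l = n - 1\<close>.
\<close>

hide_const (open) Coset.order

section \<open>Cographs split\<close>

definition compl_rel :: "('a \<Rightarrow> 'a \<Rightarrow> bool) \<Rightarrow> 'a \<Rightarrow> 'a \<Rightarrow> bool" where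
  "compl_rel E u v \<longleftrightarrow> u \<noteq> v \<and> \<not> E u v"

definition P4_free_on :: "('a \<Rightarrow> 'a \<Rightarrow> bool) \<Rightarrow> 'a set \<Rightarrow> bool" where
  "P4_free_on E S \<longleftrightarrow>
     (\<forall>a\<in>S. \<forall>b\<in>S. \<forall>c\<in>S. \<forall>d\<in>S. distinct [a, b, c, d] \<longrightarrow> E a b \<longrightarrow> E b c \<longrightarrow> E c d \<longrightarrow>
        E a c \<or> E a d \<or> E b d)"

text \<open>For symmetric \<open>E\<close> this is a disconnection of the graph induced on
  \<open>S\<close>. A split for \<open>compl_rel E\<close> is a join: all pairs across it are
  related by \<open>E\<close>.\<close>

definition split_on :: "('a \<Rightarrow> 'a \<Rightarrow> bool) \<Rightarrow> 'a set \<Rightarrow> 'a set \<Rightarrow> 'a set \<Rightarrow> bool" where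
  "split_on E S X Y \<longleftrightarrow>
     S = X \<union> Y \<and> X \<inter> Y = {} \<and> X \<noteq> {} \<and> Y \<noteq> {} \<and> (\<forall>u\<in>X. \<forall>v\<in>Y. \<not> E u v)"

lemma symp_compl_rel: "symp E \<Longrightarrow> symp (compl_rel E)"
  by (auto simp: symp_def compl_rel_def)

lemma irreflp_compl_rel: "irreflp (compl_rel E)"
  by (auto simp: irreflp_def compl_rel_def)

lemma compl_rel_compl_rel: "irreflp E \<Longrightarrow> compl_rel (compl_rel E) = E"
  by (auto simp: irreflp_def compl_rel_def fun_eq_iff)

lemma P4_free_on_subset: "P4_free_on E S \<Longrightarrow> T \<subseteq> S \<Longrightarrow> P4_free_on E T"
  unfolding P4_free_on_def by blast

text \<open>The complement of the path \<open>a, b, c, d\<close> is the path \<open>b, d, a, c\<close>.\<close>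

lemma P4_free_on_compl_rel:
  assumes "symp E" "P4_free_on E S"
  shows "P4_free_on (compl_rel E) S"
  unfolding P4_free_on_def
proof (intro ballI impI)
  fix a b c d assume "a \<in> S" "b \<in> S" "c \<in> S" "d \<in> S" and d: "distinct [a, b, c, d]"
    and "compl_rel E a b" "compl_rel E b c" "compl_rel E c d"
  show "compl_rel E a c \<or> compl_rel E a d \<or> compl_rel E b d"
  proof (rule ccontr)
    assume "\<not> ?thesis"
    then have "E a c" "E a d" "E b d" "\<not> E a b" "\<not> E b c" "\<not> E c d"
      using d \<open>compl_rel E a b\<close> \<open>compl_rel E b c\<close> \<open>compl_rel E c d\<close> by (auto simp: compl_rel_def)
    moreover have "distinct [b, d, a, c]" using d by auto
    ultimately show False
      using assms \<open>a \<in> S\<close> \<open>b \<in> S\<close> \<open>c \<in> S\<close> \<open>d \<in> S\<close> unfolding P4_free_on_def symp_def by blast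
  qed
qed

lemma split_on_commute: "symp E \<Longrightarrow> split_on E S X Y \<Longrightarrow> split_on E S Y X"
  unfolding split_on_def symp_def by blast

text \<open>
  If \<open>v\<close> has a neighbour \<open>c\<close> in \<open>Y\<close>, then an edge \<open>ab\<close> inside \<open>X\<close> with \<open>v\<close> adjacent to \<open>a\<close> but
  not to \<open>b\<close> gives the induced path \<open>b, a, v, c\<close>, so the non-neighbours of \<open>v\<close> in \<open>X\<close> are cut off.
\<close>

lemma split_on_insert_aux:
  assumes sym: "symp E" and free: "P4_free_on E (insert v S)"
    and v: "v \<notin> S" and sp: "split_on E S X Y" and u: "u \<in> X" "\<not> E v u"
  shows "\<exists>X' Y'. split_on E (insert v S) X' Y'"
proof (cases "\<exists>c\<in>Y. E v c")
  case False
  then have "split_on E (insert v S) (insert v X) Y"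
    using sp v unfolding split_on_def by blast
  then show ?thesis by blast
next
  case True
  then obtain c where c: "c \<in> Y" "E v c" by blast
  let ?N = "{x \<in> X. \<not> E v x}"
  have "\<not> E b a" if b: "b \<in> ?N" and a: "a \<in> insert v S - ?N" for a b
  proof
    assume ba: "E b a"
    have "a \<noteq> v" using b ba sym unfolding symp_def by blast
    moreover have "a \<notin> Y" using b ba sp unfolding split_on_def by blast
    ultimately have aX: "a \<in> X" "E v a" using a sp unfolding split_on_def by blast+
    have "distinct [b, a, v, c]" "\<not> E b v" "\<not> E b c" "\<not> E a c"
      using aX b c v sp sym unfolding split_on_def symp_def by auto
    moreover have "E a v" using aX(2) sym unfolding symp_def by blast
    moreover have "b \<in> insert v S" "a \<in> insert v S" "c \<in> insert v S"
      using aX b c sp unfolding split_on_def by auto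
    ultimately show False using free ba c(2) unfolding P4_free_on_def by blast
  qed
  then have "split_on E (insert v S) ?N (insert v S - ?N)"
    using u v sp unfolding split_on_def by blast
  then show ?thesis by blast
qed

text \<open>If \<open>v\<close> is adjacent to all of \<open>S\<close>, it is isolated in the
  complement and splits off there. Otherwise a non-neighbour of \<open>v\<close> lies on one of the
  sides, which by symmetry may be called \<open>X\<close>.\<close>

lemma split_on_insert:
  assumes sym: "symp E" and free: "P4_free_on E (insert v S)"
    and v: "v \<notin> S" and sp: "split_on E S X Y"
  shows "\<exists>X Y. split_on E (insert v S) X Y \<or> split_on (compl_rel E) (insert v S) X Y"
proof (cases "\<exists>u\<in>S. \<not> E v u")
  case True
  then obtain u where "u \<in> S" "\<not> E v u" by blast
  then consider "u \<in> X" | "u \<in> Y" using sp unfolding split_on_def by blast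
  then show ?thesis
    using split_on_insert_aux[OF sym free v] sp split_on_commute[OF sym sp] \<open>\<not> E v u\<close>
    by metis
next
  case False
  then have "split_on (compl_rel E) (insert v S) {v} S"
    using v sp unfolding split_on_def compl_rel_def by blast
  then show ?thesis by blast
qed

text \<open>Vertices are added one at a time. If the complement of the smaller graph splits, the
  insertion step is applied to \<open>compl_rel E\<close>, which is again P4-free, and the double
  complement leads back to \<open>E\<close>.\<close>

lemma P4_free_split:
  assumes "finite S" "symp E" "irreflp E" "P4_free_on E S" "2 \<le> card S"
  shows "\<exists>X Y. split_on E S X Y \<or> split_on (compl_rel E) S X Y"
  using assms
proof (induction S rule: finite_induct)
  case empty
  then show ?case by simp
next
  case (insert v S)
  show ?case
  proof (cases "2 \<le> card S")
    case True
    then obtain X Y where "split_on E S X Y \<or> split_on (compl_rel E) S X Y"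
      using insert P4_free_on_subset[of E "insert v S" S] by blast
    then show ?thesis
    proof
      assume "split_on E S X Y"
      then show ?thesis using split_on_insert[of E v S] insert by blast
    next
      assume "split_on (compl_rel E) S X Y"
      then have "\<exists>X Y. split_on (compl_rel E) (insert v S) X Y \<or>
          split_on (compl_rel (compl_rel E)) (insert v S) X Y"
        using insert
        by (intro split_on_insert symp_compl_rel P4_free_on_compl_rel)
      then show ?thesis using compl_rel_compl_rel[of E] insert.prems by auto
    qed
  next
    case False
    then have "card S = 1" using insert by simp
    then obtain u where u: "S = {u}" by (rule card_1_singletonE)
    then have "split_on E (insert v S) {v} {u} \<or> split_on (compl_rel E) (insert v S) {v} {u}"
      using insert.hyps by (auto simp: split_on_def compl_rel_def)
    then show ?thesis by blast
  qed
qed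

section \<open>Determining sets and chain covers\<close>

text \<open>Neighbourhoods are restricted to \<open>S\<close>, so a chain for \<open>S\<close>
  remains one for every subset of \<open>S\<close>; this lets an induction descend to induced
  subgraphs.\<close>

definition chain_on :: "('a \<Rightarrow> 'a \<Rightarrow> bool) \<Rightarrow> 'a set \<Rightarrow> 'a set \<Rightarrow> bool" where
  "chain_on E S C \<longleftrightarrow>
     (\<forall>u\<in>C. \<forall>v\<in>C. (\<forall>w\<in>S. E u w \<longrightarrow> E v w \<or> w = v) \<or> (\<forall>w\<in>S. E v w \<longrightarrow> E u w \<or> w = u))"

text \<open>
  With \<open>A\<close> the adjacency matrix of the graph induced on \<open>S\<close>: a vector \<open>x\<close> for which \<open>Ax - lx\<close> is
  constant is determined by its entries on \<open>T\<close>. Allowing any constant instead of \<open>0\<close> is what makes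
  the notion invariant under complementation.
\<close>

definition determines :: "('a \<Rightarrow> 'a \<Rightarrow> bool) \<Rightarrow> 'a set \<Rightarrow> 'b::field \<Rightarrow> 'a set \<Rightarrow> bool" where
  "determines E S l T \<longleftrightarrow>
     (\<forall>x t. (\<forall>v\<in>S. (\<Sum>w\<in>{w\<in>S. E v w}. x w) - l * x v = t) \<longrightarrow> (\<forall>v\<in>T. x v = 0) \<longrightarrow>
        (\<forall>v\<in>S. x v = 0))"

definition chain_bounded :: "('a \<Rightarrow> 'a \<Rightarrow> bool) \<Rightarrow> 'a set \<Rightarrow> 'b::field \<Rightarrow> bool" where
  "chain_bounded E S l \<longleftrightarrow>
     (\<forall>\<C>. finite \<C> \<longrightarrow> (\<forall>C\<in>\<C>. chain_on E S C) \<longrightarrow> \<Union>\<C> = S \<longrightarrow>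
        (\<exists>T\<subseteq>S. card T \<le> card \<C> \<and> determines E S l T))"

text \<open>Complementation reverses the vicinal preorder, so comparable vertices stay
  comparable.\<close>

lemma chain_on_compl_rel:
  assumes "irreflp E" "C \<subseteq> S" "chain_on E S C"
  shows "chain_on (compl_rel E) S C"
proof -
  have "\<forall>w\<in>S. compl_rel E u w \<longrightarrow> compl_rel E v w \<or> w = v"
    if "\<forall>w\<in>S. E v w \<longrightarrow> E u w \<or> w = u" for u v
    using that by (auto simp: compl_rel_def)
  then show ?thesis using assms(3) unfolding chain_on_def by blast
qed

lemma determines_compl_rel:
  fixes l :: "'b::field"
  assumes fin: "finite S" and irr: "irreflp E" and det: "determines (compl_rel E) S (- 1 - l) T"
  shows "determines E S l T"
  unfolding determines_def
proof (intro allI impI)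
  fix x :: "'a \<Rightarrow> 'b" and t
  assume eq: "\<forall>v\<in>S. (\<Sum>w\<in>{w\<in>S. E v w}. x w) - l * x v = t" and T: "\<forall>v\<in>T. x v = 0"
  \<comment> \<open>The neighbour sums at \<open>v\<close> in the graph and in its complement add up
    to \<open>sum x S - x v\<close>, so the constant \<open>t\<close> turns into
    \<open>sum x S - t\<close>.\<close>
  have "(\<Sum>w\<in>{w\<in>S. compl_rel E v w}. x w) - (- 1 - l) * x v = sum x S - t" if v: "v \<in> S" for v
  proof -
    have "S = {v} \<union> {w\<in>S. compl_rel E v w} \<union> {w\<in>S. E v w}"
      using v by (auto simp: compl_rel_def)
    then have "sum x S = sum x ({v} \<union> {w\<in>S. compl_rel E v w} \<union> {w\<in>S. E v w})" by simp
    also have "\<dots> = x v + (\<Sum>w\<in>{w\<in>S. compl_rel E v w}. x w) + (\<Sum>w\<in>{w\<in>S. E v w}. x w)"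
      using fin irr by (subst sum.union_disjoint; auto simp: compl_rel_def irreflp_def)
    finally show ?thesis using bspec[OF eq v] by (simp add: algebra_simps)
  qed
  then show "\<forall>v\<in>S. x v = 0" using det T unfolding determines_def by blast
qed

lemma chain_bounded_compl_rel:
  fixes l :: "'b::field"
  assumes "finite S" "irreflp E" "chain_bounded (compl_rel E) S (- 1 - l)"
  shows "chain_bounded E S l"
  unfolding chain_bounded_def
proof (intro allI impI)
  fix \<C> assume C: "finite \<C>" "\<forall>C\<in>\<C>. chain_on E S C" "\<Union>\<C> = S"
  then have "\<forall>C\<in>\<C>. chain_on (compl_rel E) S C"
    using chain_on_compl_rel[OF assms(2)] by blast
  then obtain T where "T \<subseteq> S" "card T \<le> card \<C>" "determines (compl_rel E) S (- 1 - l) T"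
    using assms(3)[unfolded chain_bounded_def, rule_format, of \<C>] C(1,3) by blast
  then show "\<exists>T\<subseteq>S. card T \<le> card \<C> \<and> determines E S l T"
    using determines_compl_rel[OF assms(1,2)] by blast
qed

text \<open>A set \<open>T\<close> that works for \<open>S\<close> still works with \<open>v\<close>
  added: once \<open>x\<close> vanishes on \<open>S\<close>, the equation at any vertex of
  \<open>S\<close> gives \<open>t = 0\<close>, and then the equation at \<open>v\<close> reads
  \<open>- l * x v = 0\<close>.\<close>

lemma chain_bounded_insert_isolated:
  fixes l :: "'b::field"
  assumes "symp E" "irreflp E" "S \<noteq> {}" "v \<notin> S" and iso: "\<forall>u\<in>S. \<not> E v u" and l: "l \<noteq> 0"
    and bd: "chain_bounded E S l"
  shows "chain_bounded E (insert v S) l"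
  unfolding chain_bounded_def
proof (intro allI impI)
  fix \<C> assume C: "finite \<C>" "\<forall>C\<in>\<C>. chain_on E (insert v S) C" "\<Union>\<C> = insert v S"
  \<comment> \<open>Deleting \<open>v\<close> may identify two chains but never increases their
    number.\<close>
  let ?\<C> = "(\<lambda>C. C - {v}) ` \<C>"
  have "\<Union>?\<C> = S" using C(3) \<open>v \<notin> S\<close> by blast
  moreover have "\<forall>C\<in>?\<C>. chain_on E S C" using C(2) unfolding chain_on_def by blast
  ultimately obtain T where T: "T \<subseteq> S" "card T \<le> card ?\<C>" "determines E S l T"
    using bd[unfolded chain_bounded_def, rule_format, of ?\<C>] C(1) by blast
  have nb: "{w \<in> insert v S. E u w} = {w \<in> S. E u w}" if "u \<in> S" for u
    using iso that \<open>symp E\<close> unfolding symp_def by blast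
  have nbv: "{w \<in> insert v S. E v w} = {}" using iso \<open>irreflp E\<close> unfolding irreflp_def by blast
  have "determines E (insert v S) l T"
    unfolding determines_def
  proof (intro allI impI)
    fix x :: "'a \<Rightarrow> 'b" and t
    assume eq: "\<forall>u\<in>insert v S. (\<Sum>w\<in>{w\<in>insert v S. E u w}. x w) - l * x u = t"
      and "\<forall>u\<in>T. x u = 0"
    then have S0: "\<forall>u\<in>S. x u = 0"
      using T(3) nb unfolding determines_def by fastforce
    moreover obtain u where "u \<in> S" using \<open>S \<noteq> {}\<close> by blast
    ultimately have "t = 0" using bspec[OF eq, of u] nb[of u] by simp
    then have "x v = 0" using bspec[OF eq, of v, unfolded nbv] l by simp
    then show "\<forall>u\<in>insert v S. x u = 0" using S0 by blast
  qed
  moreover have "card T \<le> card \<C>" using T(2) card_image_le[OF C(1)] by (rule order_trans)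
  ultimately show "\<exists>T\<subseteq>insert v S. card T \<le> card \<C> \<and> determines E (insert v S) l T"
    using T(1) by blast
qed

text \<open>No edge crosses the split, so the restriction of \<open>x\<close> to either side
  satisfies the equations of that side with the same \<open>t\<close>.\<close>

lemma determines_Un:
  fixes l :: "'b::field"
  assumes "symp E" and sp: "split_on E S X Y" and "determines E X l T" "determines E Y l U"
  shows "determines E S l (T \<union> U)"
  unfolding determines_def
proof (intro allI impI)
  fix x :: "'a \<Rightarrow> 'b" and t
  assume eq: "\<forall>u\<in>S. (\<Sum>w\<in>{w\<in>S. E u w}. x w) - l * x u = t" and "\<forall>u\<in>T \<union> U. x u = 0"
  have "{w \<in> S. E u w} = {w \<in> X. E u w}" if "u \<in> X" for u
    using sp that unfolding split_on_def by blast
  moreover have "{w \<in> S. E u w} = {w \<in> Y. E u w}" if "u \<in> Y" for u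
    using sp that \<open>symp E\<close> unfolding split_on_def symp_def by blast
  ultimately have "\<forall>u\<in>X. (\<Sum>w\<in>{w\<in>X. E u w}. x w) - l * x u = t"
      "\<forall>u\<in>Y. (\<Sum>w\<in>{w\<in>Y. E u w}. x w) - l * x u = t"
    using eq sp unfolding split_on_def by (metis UnI1, metis UnI2)
  then have "\<forall>u\<in>X. x u = 0" "\<forall>u\<in>Y. x u = 0"
    using assms(3,4) \<open>\<forall>u\<in>T \<union> U. x u = 0\<close> unfolding determines_def by blast+
  then show "\<forall>u\<in>S. x u = 0" using sp unfolding split_on_def by blast
qed

lemma chain_bounded_split:
  fixes l :: "'b::field"
  assumes "symp E" and sp: "split_on E S X Y" and bd: "chain_bounded E X l" "chain_bounded E Y l"
    and noiso: "\<forall>v\<in>S. \<exists>u\<in>S. E v u"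
  shows "chain_bounded E S l"
  unfolding chain_bounded_def
proof (intro allI impI)
  fix \<C> assume C: "finite \<C>" "\<forall>C\<in>\<C>. chain_on E S C" "\<Union>\<C> = S"
  (* Without isolated vertices, vertices on different sides of the split are incomparable. *)
  have side: "C \<subseteq> X \<or> C \<subseteq> Y" if "C \<in> \<C>" for C
  proof (rule ccontr)
    assume "\<not> ?thesis"
    moreover have "C \<subseteq> X \<union> Y"
      using Union_upper[OF that] C(3) sp by (simp add: split_on_def)
    ultimately obtain u v where uv: "u \<in> C" "u \<in> X" "v \<in> C" "v \<in> Y" by blast
    then have "u \<in> S" "v \<in> S" using sp by (simp_all add: split_on_def)
    then obtain u' v' where uv': "u' \<in> S" "E u u'" "v' \<in> S" "E v v'"
      using noiso by blast
    have "u' \<in> X" "v' \<in> Y" using uv uv' sp \<open>symp E\<close> unfolding split_on_def symp_def by blast+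
    then have "\<not> E v u'" "u' \<noteq> v" "\<not> E u v'" "v' \<noteq> u"
      using uv sp \<open>symp E\<close> unfolding split_on_def symp_def by blast+
    moreover have "(\<forall>w\<in>S. E u w \<longrightarrow> E v w \<or> w = v) \<or> (\<forall>w\<in>S. E v w \<longrightarrow> E u w \<or> w = u)"
      using bspec[OF C(2) that] uv(1,3) unfolding chain_on_def by blast
    ultimately show False using uv' by blast
  qed
  \<comment> \<open>With the empty chain left out no set lies on both sides, so the two families are
    disjoint and their sizes add up to at most that of the cover.\<close>
  define \<X> \<Y> where "\<X> = {C \<in> \<C>. C \<subseteq> X \<and> C \<noteq> {}}" and "\<Y> = {C \<in> \<C>. C \<subseteq> Y \<and> C \<noteq> {}}"
  have fin: "finite \<X>" "finite \<Y>" using C(1) by (auto simp: \<X>_def \<Y>_def)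
  have "\<Union>\<X> = X" "\<Union>\<Y> = Y"
    using side C(3) sp unfolding \<X>_def \<Y>_def split_on_def by blast+
  moreover have "\<forall>C\<in>\<X>. chain_on E X C" "\<forall>C\<in>\<Y>. chain_on E Y C"
    using C(2) sp unfolding \<X>_def \<Y>_def split_on_def chain_on_def by blast+
  ultimately have "\<exists>T\<subseteq>X. card T \<le> card \<X> \<and> determines E X l T"
      "\<exists>U\<subseteq>Y. card U \<le> card \<Y> \<and> determines E Y l U"
    using bd fin unfolding chain_bounded_def by simp_all
  then obtain T U where T: "T \<subseteq> X" "card T \<le> card \<X>" "determines E X l T"
    and U: "U \<subseteq> Y" "card U \<le> card \<Y>" "determines E Y l U"
    by blast
  have "card (T \<union> U) \<le> card T + card U" by (rule card_Un_le)
  also have "\<dots> \<le> card \<X> + card \<Y>" using T U by simp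
  also have "\<dots> = card (\<X> \<union> \<Y>)"
    using fin sp by (intro card_Un_disjoint[symmetric]) (auto simp: \<X>_def \<Y>_def split_on_def)
  also have "\<dots> \<le> card \<C>" using C(1) by (intro card_mono) (auto simp: \<X>_def \<Y>_def)
  finally have "card (T \<union> U) \<le> card \<C>" .
  moreover have "T \<union> U \<subseteq> S" using T U sp unfolding split_on_def by blast
  ultimately show "\<exists>T\<subseteq>S. card T \<le> card \<C> \<and> determines E S l T"
    using determines_Un[OF \<open>symp E\<close> sp T(3) U(3)] by blast
qed

text \<open>An isolated vertex is comparable to every vertex, so chains could cross the split; such
  a vertex is removed instead of splitting. What remains need not be \<open>X\<close> or
  \<open>Y\<close>, hence the assumption on all proper subsets.\<close>

lemma chain_bounded_disconnected:
  fixes l :: "'b::field"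
  assumes "symp E" "irreflp E" "l \<noteq> 0" and sp: "split_on E S X Y"
    and bd: "\<And>S'. S' \<subset> S \<Longrightarrow> chain_bounded E S' l"
  shows "chain_bounded E S l"
proof (cases "\<forall>v\<in>S. \<exists>u\<in>S. E v u")
  case True
  moreover have "X \<subset> S" "Y \<subset> S" using sp unfolding split_on_def by blast+
  ultimately show ?thesis using chain_bounded_split[OF assms(1) sp] bd by blast
next
  case False
  then obtain v where v: "v \<in> S" "\<forall>u\<in>S. \<not> E v u" by blast
  have "S - {v} \<noteq> {}" using sp unfolding split_on_def by blast
  moreover have "chain_bounded E (S - {v}) l" using v(1) by (intro bd) blast
  ultimately have "chain_bounded E (insert v (S - {v})) l"
    using assms(1-3) v by (intro chain_bounded_insert_isolated) simp_all
  then show ?thesis using v(1) by (simp add: insert_absorb)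
qed

text \<open>The induction generalises over \<open>E\<close> and \<open>l\<close> because the
  complement case changes both. The map from \<open>l\<close> to \<open>- 1 - l\<close> swaps the
  excluded values \<open>0\<close> and \<open>- 1\<close>.\<close>

theorem P4_free_chain_bounded:
  fixes l :: "'b::field"
  assumes "finite S" "symp E" "irreflp E" "P4_free_on E S" "l \<noteq> 0" "l \<noteq> - 1"
  shows "chain_bounded E S l"
  using assms
proof (induction S arbitrary: E l rule: finite_psubset_induct)
  case (psubset S)
  have "card S = 0 \<or> card S = 1 \<or> 2 \<le> card S" by linarith
  then consider "S = {}" | v where "S = {v}" | "2 \<le> card S"
    using \<open>finite S\<close> by (metis card_0_eq card_1_singletonE)
  then show ?case
  proof cases
    case 1
    then show ?thesis by (auto simp: chain_bounded_def determines_def)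
  next
    case 2
    \<comment> \<open>A cover of a single vertex is non-empty, so that vertex itself may serve as
      \<open>T\<close>.\<close>
    have "1 \<le> card \<C>" if "finite \<C>" "\<Union>\<C> = S" for \<C>
      using that 2 by (auto simp: Suc_le_eq card_gt_0_iff)
    then show ?thesis using 2
      by (auto simp: chain_bounded_def determines_def intro!: exI[of _ "{v}"])
  next
    case 3
    obtain X Y where "split_on E S X Y \<or> split_on (compl_rel E) S X Y"
      using P4_free_split[OF psubset.hyps psubset.prems(1-3) 3] by (elim exE)
    moreover have free: "P4_free_on E S'" if "S' \<subset> S" for S'
      using P4_free_on_subset[OF psubset.prems(3)] that by blast
    ultimately show ?thesis
    proof (elim disjE)
      assume "split_on E S X Y"
      then show ?thesis
        using psubset.prems free
        by (intro chain_bounded_disconnected[of E l S X Y] psubset.IH) simp_all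
    next
      assume sp: "split_on (compl_rel E) S X Y"
      have l: "- 1 - l \<noteq> 0" "- 1 - l \<noteq> - 1" using psubset.prems
        by (auto simp: algebra_simps)
      have "chain_bounded (compl_rel E) S' (- 1 - l)" if "S' \<subset> S" for S'
        using psubset.prems free that l
        by (intro psubset.IH symp_compl_rel irreflp_compl_rel P4_free_on_compl_rel) simp_all
      then have "chain_bounded (compl_rel E) S (- 1 - l)"
        using psubset.prems sp l
        by (intro chain_bounded_disconnected[of "compl_rel E" "- 1 - l" S X Y] symp_compl_rel
            irreflp_compl_rel) simp_all
      then show ?thesis
        by (rule chain_bounded_compl_rel[OF psubset.hyps psubset.prems(2)])
    qed
  qed
qed

section \<open>Algebraic multiplicity of eigenvalues of real symmetric matrices\<close>

text \<open>Reading off the coordinates in \<open>T\<close> is a linear map on the kernel, injective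
  by \<open>det\<close>. It sends a basis to an independent set in a space of dimension
  \<open>card T\<close>.\<close>

lemma kernel_dim_le_card:
  fixes A :: "'a::field mat"
  assumes A: "A \<in> carrier_mat nr nc" and T: "finite T" "T \<subseteq> {..<nc}"
    and det: "\<And>v. v \<in> mat_kernel A \<Longrightarrow> (\<And>i. i \<in> T \<Longrightarrow> v $ i = 0) \<Longrightarrow> v = 0\<^sub>v nc"
  shows "kernel_dim A \<le> card T"
proof -
  interpret kernel nr nc A by unfold_locales (rule A)
  obtain ts where ts: "set ts = T" "length ts = card T"
    using finite_distinct_list[OF T(1)] distinct_card by metis
  define k where "k = card T"
  interpret W: vec_space "TYPE('a)" k .
  define f where "f v = vec k (\<lambda>i. v $ (ts ! i))" for v :: "'a vec"
  have tsn: "ts ! i < nc" if "i < k" for i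
    using that T(2) ts nth_mem[of i ts] unfolding k_def by auto
  note carr = mat_kernelD(1)[OF A]
  have hom: "f \<in> module_hom class_ring VK W.V"
    unfolding module_hom_def
    using tsn by (auto simp: f_def module_vec_simps dest!: carr)
  interpret lm: linear_map class_ring VK W.V f
    using hom by unfold_locales
  have f0: "v = 0\<^sub>v nc" if "v \<in> mat_kernel A" "f v = 0\<^sub>v k" for v
  proof (rule det[OF that(1)])
    fix i assume "i \<in> T"
    then obtain j where "j < k" "i = ts ! j" using ts by (metis in_set_conv_nth k_def)
    then show "v $ i = 0" using that(2) by (metis f_def index_vec index_zero_vec(1))
  qed
  obtain B where B: "finite B" "basis B" using kernel_basis_exists[OF A] by blast
  have inj: "inj_on f (mat_kernel A)"
  proof -
    have "0\<^sub>v nc \<in> mat_kernel A" "f (0\<^sub>v nc) = 0\<^sub>v k"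
      using A tsn by (auto simp: f_def intro!: mat_kernelI)
    then have "lm.kerT = {0\<^sub>v nc}"
      using f0 by (auto simp: lm.ker_def module_vec_simps)
    then show ?thesis using lm.Ke0_imp_inj by simp
  qed
  have BA: "B \<subseteq> mat_kernel A" and indpt: "\<not> Ker.lin_dep B"
    using B(2) unfolding Ker.basis_def by auto
  have "\<not> W.lin_dep (f ` B)"
  proof (rule W.finite_lin_indpt2)
    show "finite (f ` B)" using B(1) by simp
    show "f ` B \<subseteq> carrier_vec k" by (auto simp: f_def)
    fix a :: "'a vec \<Rightarrow> 'a" assume 0: "W.lincomb a (f ` B) = 0\<^sub>v k"
    have "W.lincomb a (f ` B) = f (Ker.lincomb (a \<circ> f) B)"
      using lm.lincomb_linear_image[of B a] inj BA B(1) by (simp add: class_ring_simps)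
    then have "Ker.lincomb (a \<circ> f) B = 0\<^sub>v nc"
      using 0 BA by (intro f0 Ker.lincomb_closed) (auto simp: class_ring_simps)
    then have "a \<circ> f \<in> B \<rightarrow> {0}"
      using Ker.not_lindepD[OF indpt B(1) subset_refl, of "a \<circ> f"] by (simp add: class_ring_simps)
    then show "\<forall>v\<in>f ` B. a v = 0" by auto
  qed
  then have "card (f ` B) \<le> W.dim"
    by (intro W.li_le_dim(2)) (auto simp: f_def)
  moreover have "card (f ` B) = Ker.dim"
    using card_image[OF inj_on_subset[OF inj BA]] Ker.dim_basis[OF B] by simp
  ultimately show ?thesis using W.dim_is_n kernel_dim k_def by simp
qed

text \<open>If \<open>v\<close> is killed by the power \<open>k + 2\<close> of \<open>B\<close>,
  then \<open>B v\<close> is killed by the power \<open>k + 1\<close>, hence by \<open>B\<close>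
  itself by induction, and \<open>sq\<close> yields \<open>B v = 0\<close>.\<close>

lemma mat_kernel_pow:
  fixes B :: "'a::field mat"
  assumes B: "B \<in> carrier_mat n n"
    and sq: "\<And>v. v \<in> carrier_vec n \<Longrightarrow> B *\<^sub>v (B *\<^sub>v v) = 0\<^sub>v n \<Longrightarrow> B *\<^sub>v v = 0\<^sub>v n"
    and k: "0 < k"
  shows "mat_kernel (B ^\<^sub>m k) = mat_kernel B"
proof -
  have "v \<in> mat_kernel B" if "v \<in> mat_kernel (B ^\<^sub>m Suc k)" for k v
    using that
  proof (induction k arbitrary: v)
    case 0
    then show ?case using B by simp
  next
    case (Suc k)
    have v: "v \<in> carrier_vec n" "B ^\<^sub>m Suc (Suc k) *\<^sub>v v = 0\<^sub>v n"
      using mat_kernelD[OF pow_carrier_mat[OF B] Suc.prems] by auto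
    have "B ^\<^sub>m Suc k *\<^sub>v (B *\<^sub>v v) = 0\<^sub>v n"
      using v B assoc_mult_mat_vec[OF pow_carrier_mat[OF B] B v(1), of "Suc k"] by simp
    then have "B *\<^sub>v v \<in> mat_kernel (B ^\<^sub>m Suc k)"
      using B v by (intro mat_kernelI[OF pow_carrier_mat[OF B]]) auto
    then have "B *\<^sub>v v \<in> mat_kernel B" by (rule Suc.IH)
    then show ?case
      using sq[OF v(1)] v B by (intro mat_kernelI[OF B]) (auto dest: mat_kernelD[OF B])
  qed
  moreover have "mat_kernel B \<subseteq> mat_kernel (B ^\<^sub>m Suc k)" for k
    using mat_kernel_mult_subset[OF B pow_carrier_mat[OF B]] by simp
  ultimately show ?thesis using k by (metis Suc_pred subsetI subset_antisym)
qed

text \<open>The algebraic multiplicity is the total size of the Jordan blocks for \<open>l\<close>.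
  The kernel of a high power of \<open>A - l\<close> has this dimension, and by \<open>sq\<close> it
  is already the eigenspace.\<close>

lemma order_char_poly_eq_kernel_dim:
  fixes A :: "complex mat"
  assumes A: "A \<in> carrier_mat n n"
    and sq: "\<And>v. v \<in> carrier_vec n \<Longrightarrow> char_matrix A l *\<^sub>v (char_matrix A l *\<^sub>v v) = 0\<^sub>v n \<Longrightarrow>
      char_matrix A l *\<^sub>v v = 0\<^sub>v n"
  shows "order l (char_poly A) = kernel_dim (char_matrix A l)"
proof -
  have B: "char_matrix A l \<in> carrier_mat n n" using A by simp
  obtain n_as where jnf: "jordan_nf A n_as"
    using jordan_nf_exists[OF A] char_poly_factorized[OF A] by metis
  let ?ns = "map fst [(n, e)\<leftarrow>n_as . e = l]"
  \<comment> \<open>This \<open>k\<close> exceeds every block size, so \<open>min k\<close> leaves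
    the sizes unchanged; \<open>Suc\<close> also makes it positive, as \<open>mat_kernel_pow\<close>
    demands.\<close>
  define k where "k = Suc (sum_list ?ns)"
  have "order l (char_poly A) = sum_list ?ns"
    using jordan_nf_order[OF jnf, of l] by (simp add: case_prod_beta')
  also have "\<dots> = sum_list (map (min k) ?ns)"
    using member_le_sum_list[of _ ?ns]
    by (intro arg_cong[of _ _ sum_list] map_idI[symmetric]) (fastforce simp: k_def)
  also have "\<dots> = kernel_dim (char_matrix A l ^\<^sub>m k)"
    using dim_gen_eigenspace[OF jnf, of l k] by (simp add: dim_gen_eigenspace_def comp_def)
  also have "\<dots> = kernel_dim (char_matrix A l)"
    using mat_kernel_pow[OF B sq, of k] B pow_carrier_mat[OF B, of k]
    by (simp add: kernel_dim_def k_def)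
  finally show ?thesis .
qed

text \<open>Put \<open>u = B v\<close>. By symmetry the Hermitian square of \<open>u\<close> is the
  product of \<open>v\<close> with \<open>B\<close> applied to the conjugate of \<open>u\<close>; as
  \<open>B\<close> is real, that vector is the conjugate of \<open>B u = 0\<close>.\<close>

lemma real_symmetric_kernel_square:
  fixes B :: "complex mat"
  assumes B: "B \<in> carrier_mat n n" and sym: "transpose_mat B = B"
    and real: "map_mat cnj B = B"
    and v: "v \<in> carrier_vec n" and 0: "B *\<^sub>v (B *\<^sub>v v) = 0\<^sub>v n"
  shows "B *\<^sub>v v = 0\<^sub>v n"
proof -
  let ?u = "B *\<^sub>v v"
  have u: "?u \<in> carrier_vec n" using B v by simp
  have cnj_B: "cnj (B $$ (i, j)) = B $$ (i, j)" if "i < n" "j < n" for i j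
    using arg_cong[OF real, of "\<lambda>M. M $$ (i, j)"] B that by simp
  have "B *\<^sub>v conjugate ?u = conjugate (B *\<^sub>v ?u)"
    using B u by (intro eq_vecI) (auto simp: scalar_prod_def cnj_B)
  also have "\<dots> = 0\<^sub>v n" unfolding 0 by (intro eq_vecI) auto
  finally have "B *\<^sub>v conjugate ?u = 0\<^sub>v n" .
  then have "?u \<bullet>c ?u = 0"
    using transpose_vec_mult_scalar[OF B v carrier_vec_conjugate[OF u]] sym v B u
    by (metis carrier_vec_conjugate comm_scalar_prod scalar_prod_left_zero zero_carrier_vec)
  then show ?thesis using conjugate_square_eq_0_vec[OF u] by simp
qed

text \<open>Jordan normal forms are taken over the complex numbers, where the characteristic
  polynomial factors; this carries multiplicities back to the reals.\<close>

lemma order_char_poly_of_real: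
  fixes A :: "real mat"
  assumes "A \<in> carrier_mat n n"
  shows "order (complex_of_real l) (char_poly (map_mat complex_of_real A)) = order l (char_poly A)"
proof -
  interpret map_poly_inj_idom_divide_hom "of_real :: real \<Rightarrow> complex" ..
  show ?thesis
    using order_hom[of l "char_poly A"] of_real_hom.char_poly_hom[OF assms, where 'a = complex]
    by simp
qed

text \<open>For a real symmetric matrix the multiplicity is the dimension of the complex eigenspace,
  so it is bounded by the size of any coordinate set that determines the eigenvectors.\<close>

lemma order_char_poly_real_symmetric_le_card:
  fixes A :: "real mat"
  assumes A: "A \<in> carrier_mat n n" and sym: "transpose_mat A = A" and T: "T \<subseteq> {..<n}"
    and det: "\<And>v. v \<in> carrier_vec n \<Longrightarrow>
      (\<And>i. i < n \<Longrightarrow> (\<Sum>j<n. complex_of_real (A $$ (i, j)) * v $ j) = of_real l * v $ i) \<Longrightarrow>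
      (\<And>i. i \<in> T \<Longrightarrow> v $ i = 0) \<Longrightarrow> v = 0\<^sub>v n"
  shows "order l (char_poly A) \<le> card T"
proof -
  let ?A = "map_mat complex_of_real A"
  let ?B = "char_matrix ?A (of_real l)"
  have A': "?A \<in> carrier_mat n n" and B: "?B \<in> carrier_mat n n" using A by simp_all
  have symA: "A $$ (j, i) = A $$ (i, j)" if "i < n" "j < n" for i j
    using arg_cong[OF sym, of "\<lambda>M. M $$ (i, j)"] A that by simp
  have "transpose_mat ?B = ?B" "map_mat cnj ?B = ?B"
    using A symA by (auto simp: char_matrix_def intro!: eq_matI)
  then have "order (of_real l) (char_poly ?A) = kernel_dim ?B"
    using real_symmetric_kernel_square[OF B] by (intro order_char_poly_eq_kernel_dim[OF A']) simp
  also have "\<dots> \<le> card T"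
  proof (rule kernel_dim_le_card[OF B _ T])
    show "finite T" using T finite_subset by blast
    fix v assume v: "v \<in> mat_kernel ?B" and "\<And>i. i \<in> T \<Longrightarrow> v $ i = 0"
    have vn: "v \<in> carrier_vec n" "?B *\<^sub>v v = 0\<^sub>v n" using mat_kernelD[OF B v] by auto
    have "(\<Sum>j<n. complex_of_real (A $$ (i, j)) * v $ j) = of_real l * v $ i" if i: "i < n" for i
    proof -
      have "0 = (?B *\<^sub>v v) $ i" using vn(2) i by simp
      also have "\<dots> = (\<Sum>j<n. (of_real (A $$ (i, j)) - (if i = j then of_real l else 0)) * v $ j)"
        using A vn(1) i
        by (auto simp: char_matrix_def scalar_prod_def atLeast0LessThan intro!: sum.cong)
      also have "\<dots> = (\<Sum>j<n. of_real (A $$ (i, j)) * v $ j) - of_real l * v $ i"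
        using i by (simp add: left_diff_distrib sum_subtractf if_distrib[of "\<lambda>x. x * _"] sum.delta
            cong: if_cong)
      finally show ?thesis by simp
    qed
    then show "v = 0\<^sub>v n" using det vn(1) \<open>\<And>i. i \<in> T \<Longrightarrow> v $ i = 0\<close> by blast
  qed
  finally show ?thesis by (simp add: order_char_poly_of_real[OF A])
qed

section \<open>Multiplicity and the Dilworth number\<close>

text \<open>The singletons form a chain cover, so \<open>LEAST\<close> ranges over a non-empty set
  of sizes.\<close>

lemma dilworth_number_attained:
  assumes "finite (pverts G)"
  obtains \<C> where "finite \<C>" "card \<C> = dilworth_number G"
    "\<forall>C\<in>\<C>. vicinal_chain G C" "\<Union>\<C> = pverts G"
proof -
  let ?P = "\<lambda>k. \<exists>\<C>. finite \<C> \<and> card \<C> = k \<and> (\<forall>C\<in>\<C>. vicinal_chain G C) \<and> \<Union>\<C> = pverts G"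
  let ?S = "(\<lambda>v. {v}) ` pverts G"
  have "?P (card ?S)"
    using assms by (intro exI[of _ ?S]) (auto simp: vicinal_chain_def vicinal_le_def closed_nbhd_def)
  then have "?P (dilworth_number G)" unfolding dilworth_number_def by (rule LeastI)
  then show ?thesis using that by blast
qed

lemma vicinal_chain_imp_chain_on:
  "vicinal_chain G C \<Longrightarrow> chain_on (\<lambda>u v. (u, v) \<in> parcs G) (pverts G) C"
  unfolding vicinal_chain_def chain_on_def vicinal_le_def closed_nbhd_def open_nbhd_def by blast

lemma cograph_multiplicity_le_dilworth_number:
  fixes l :: real
  assumes G: "cograph G" and vs: "vertex_ordering G vs" and l: "l \<noteq> 0" "l \<noteq> - 1"
  shows "eigenvalue_multiplicity (adjacency_matrix G vs) l \<le> dilworth_number G"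
proof -
  interpret pair_graph G using G by (simp add: cograph_def)
  define E where "E u v \<longleftrightarrow> (u, v) \<in> parcs G" for u v
  let ?V = "pverts G"
  let ?n = "length vs"
  let ?A = "adjacency_matrix G vs"
  have sym: "symp E"
    using pair_sym_arcs by (auto simp: symp_def E_def symmetric_def sym_def)
  have irr: "irreflp E"
    using pair_no_loops[of "(u, u)" for u] by (auto simp: irreflp_def E_def)
  have free: "P4_free_on E ?V"
    unfolding P4_free_on_def E_def
  proof (intro ballI impI)
    fix a b c d
    assume "a \<in> ?V" "b \<in> ?V" "c \<in> ?V" "d \<in> ?V" "distinct [a, b, c, d]"
      "(a, b) \<in> parcs G" "(b, c) \<in> parcs G" "(c, d) \<in> parcs G"
    moreover have "\<not> has_induced_P4 G" using G by (simp add: cograph_def)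
    ultimately show "(a, c) \<in> parcs G \<or> (a, d) \<in> parcs G \<or> (b, d) \<in> parcs G"
      unfolding has_induced_P4_def by (metis empty_subsetI insert_subset)
  qed
  have "complex_of_real l \<noteq> 0" "complex_of_real l \<noteq> - 1"
    using l of_real_eq_iff[of l "- 1", where 'a = complex] by simp_all
  then have bounded: "chain_bounded E ?V (complex_of_real l)"
    by (rule P4_free_chain_bounded[OF pair_finite_verts sym irr free])
  obtain \<C> where \<C>: "finite \<C>" "card \<C> = dilworth_number G"
    "\<forall>C\<in>\<C>. vicinal_chain G C" "\<Union>\<C> = ?V"
    using dilworth_number_attained[OF pair_finite_verts] .
  then have "\<forall>C\<in>\<C>. chain_on E ?V C"
    using vicinal_chain_imp_chain_on[of G] by (auto simp: E_def[abs_def])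
  then obtain T where T: "T \<subseteq> ?V" "card T \<le> dilworth_number G"
    "determines E ?V (complex_of_real l) T"
    using bounded[unfolded chain_bounded_def, rule_format, of \<C>] \<C> by auto
  have bij: "bij_betw ((!) vs) {..<?n} ?V"
    using vs by (auto simp: vertex_ordering_def intro!: bij_betw_nth)
  \<comment> \<open>\<open>pos\<close> sends a vertex to its index and so turns the vertex set
    \<open>T\<close> into a set of coordinates.\<close>
  define pos where "pos = inv_into {..<?n} ((!) vs)"
  have bij': "bij_betw pos ?V {..<?n}" unfolding pos_def by (rule bij_betw_inv_into[OF bij])
  have pos: "vs ! pos u = u" "pos u < ?n" if "u \<in> ?V" for u
    using that bij_betw_inv_into_right[OF bij] bij_betwE[OF bij'] by (auto simp: pos_def)
  have "order l (char_poly ?A) \<le> card (pos ` T)"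
  proof (rule order_char_poly_real_symmetric_le_card)
    show "?A \<in> carrier_mat ?n ?n" by (simp add: adjacency_matrix_def)
    show "transpose_mat ?A = ?A"
      using sym by (auto simp: adjacency_matrix_def symp_def E_def intro!: eq_matI)
    show "pos ` T \<subseteq> {..<?n}" using T(1) pos by auto
    fix v :: "complex vec"
    assume v: "v \<in> carrier_vec ?n"
      and ev: "\<And>i. i < ?n \<Longrightarrow> (\<Sum>j<?n. complex_of_real (?A $$ (i, j)) * v $ j) = of_real l * v $ i"
      and v0: "\<And>i. i \<in> pos ` T \<Longrightarrow> v $ i = 0"
    let ?x = "\<lambda>u. v $ pos u"
    \<comment> \<open>An eigenvector, read as a function on vertices, solves the equations of
      \<open>determines\<close> with constant \<open>t = 0\<close>.\<close>
    have "(\<Sum>w\<in>{w\<in>?V. E u w}. ?x w) - of_real l * ?x u = 0" if u: "u \<in> ?V" for u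
    proof -
      have "of_real l * ?x u = (\<Sum>j<?n. complex_of_real (?A $$ (pos u, j)) * v $ j)"
        using ev pos(2)[OF u] by simp
      also have "\<dots> = (\<Sum>w\<in>?V. complex_of_real (?A $$ (pos u, pos w)) * ?x w)"
        by (rule sum.reindex_bij_betw[OF bij', symmetric])
      also have "\<dots> = (\<Sum>w\<in>?V. if E u w then ?x w else 0)"
        using pos u by (intro sum.cong) (auto simp: adjacency_matrix_def E_def)
      also have "\<dots> = (\<Sum>w\<in>{w\<in>?V. E u w}. ?x w)"
        by (rule sum.inter_filter[OF pair_finite_verts, symmetric])
      finally show ?thesis by simp
    qed
    then have x0: "\<forall>u\<in>?V. ?x u = 0"
      using T(3) v0 unfolding determines_def by blast
    show "v = 0\<^sub>v ?n"
    proof (rule eq_vecI)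
      fix i assume "i < dim_vec (0\<^sub>v ?n :: complex vec)"
      then have "i \<in> pos ` ?V" using bij' by (simp add: bij_betw_def)
      then show "v $ i = 0\<^sub>v ?n $ i" using x0 \<open>i < dim_vec (0\<^sub>v ?n)\<close> by auto
    qed (use v in simp)
  qed
  also have "\<dots> \<le> card T"
    using T(1) pair_finite_verts by (intro card_image_le) (rule finite_subset)
  also have "\<dots> \<le> dilworth_number G" by (rule T(2))
  finally show ?thesis by (simp add: eigenvalue_multiplicity_def)
qed

section \<open>Complete graphs attain the bound\<close>

definition complete_graph :: "nat \<Rightarrow> nat pair_pre_digraph" where
  "complete_graph n = \<lparr>pverts = {..<n}, parcs = {(u, v). u < n \<and> v < n \<and> u \<noteq> v}\<rparr>"

lemma cograph_complete_graph: "cograph (complete_graph n)"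
proof -
  have "finite {(u, v). u < n \<and> v < n \<and> u \<noteq> v}"
    by (rule finite_subset[of _ "{..<n} \<times> {..<n}"]) auto
  then have "pair_graph (complete_graph n)"
    by unfold_locales (auto simp: complete_graph_def symmetric_def sym_def)
  moreover have "\<not> has_induced_P4 (complete_graph n)"
    by (auto simp: has_induced_P4_def complete_graph_def)
  ultimately show ?thesis by (simp add: cograph_def)
qed

text \<open>Every closed neighbourhood is the whole vertex set, so one chain suffices. For
  \<open>n\<close> at least 2 the reverse inequality will come from the positive multiplicity of an
  eigenvalue.\<close>

lemma dilworth_number_complete_graph_le: "dilworth_number (complete_graph n) \<le> 1"
proof -
  have "vicinal_chain (complete_graph n) {..<n}"
    by (auto simp: vicinal_chain_def vicinal_le_def closed_nbhd_def open_nbhd_def complete_graph_def)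
  then show ?thesis
    unfolding dilworth_number_def
    by (intro Least_le exI[of _ "{{..<n}}"]) (simp add: complete_graph_def)
qed

lemma eigenvalue_complete_graph:
  assumes vs: "vertex_ordering (complete_graph n) vs" and "0 < n"
  shows "eigenvalue (adjacency_matrix (complete_graph n) vs) (real n - 1)"
proof -
  let ?A = "adjacency_matrix (complete_graph n) vs"
  \<comment> \<open>Every row of the matrix has \<open>n - 1\<close> ones, so the all-ones vector is
    an eigenvector.\<close>
  let ?v = "vec n (\<lambda>_. 1 :: real)"
  have vs': "distinct vs" "set vs = {..<n}"
    using vs by (auto simp: vertex_ordering_def complete_graph_def)
  then have len: "length vs = n" using distinct_card by fastforce
  have nth: "vs ! i < n" if "i < n" for i using vs'(2) len that nth_mem by blast
  have "?A *\<^sub>v ?v = (real n - 1) \<cdot>\<^sub>v ?v"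
  proof (rule eq_vecI)
    fix i assume "i < dim_vec ((real n - 1) \<cdot>\<^sub>v ?v)"
    then have i: "i < n" by simp
    have "(?A *\<^sub>v ?v) $ i = (\<Sum>j<n. if i = j then 0 else 1)"
      using i len nth nth_eq_iff_index_eq[OF vs'(1)]
      by (auto simp: adjacency_matrix_def scalar_prod_def complete_graph_def atLeast0LessThan
          intro!: sum.cong)
    also have "\<dots> = (\<Sum>j<n. 1 - (if i = j then 1 else 0))" by (rule sum.cong) auto
    also have "\<dots> = real n - 1" using i by (simp add: sum_subtractf)
    finally show "(?A *\<^sub>v ?v) $ i = ((real n - 1) \<cdot>\<^sub>v ?v) $ i" using i by simp
  qed (simp add: adjacency_matrix_def len)
  moreover have "?v \<noteq> 0\<^sub>v n" using \<open>0 < n\<close> by (metis index_vec index_zero_vec(1) zero_neq_one)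
  ultimately show ?thesis
    unfolding eigenvalue_def eigenvector_def
    by (intro exI[of _ ?v]) (simp add: adjacency_matrix_def len)
qed

lemma eigenvalue_multiplicity_pos:
  assumes "A \<in> carrier_mat n n" "eigenvalue A l"
  shows "0 < eigenvalue_multiplicity A l"
proof -
  have "char_poly A \<noteq> 0" using degree_monic_char_poly[OF assms(1)] by auto
  then show ?thesis
    using assms eigenvalue_root_char_poly[OF assms(1)] order_root[of "char_poly A" l]
    by (auto simp: eigenvalue_multiplicity_def)
qed

text \<open>This tells complete graphs of different sizes apart up to isomorphism.\<close>

lemma digraph_iso_card_verts:
  "digraph_iso G H \<Longrightarrow> card (verts G) = card (verts H)"
  unfolding digraph_iso_def
  by (auto simp: pre_digraph.digraph_isomorphism_def card_image)

theorem theorem3p4: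
  shows
    "(\<forall>(G :: 'a pair_pre_digraph) vs (l :: real).
        cograph G \<longrightarrow> vertex_ordering G vs \<longrightarrow>
        eigenvalue (adjacency_matrix G vs) l \<longrightarrow> l \<notin> {0, -1} \<longrightarrow>
        eigenvalue_multiplicity (adjacency_matrix G vs) l \<le> dilworth_number G)
     \<and>
     (\<exists>F :: nat pair_pre_digraph set.
        infinite F \<and>
        (\<forall>G\<in>F. \<forall>H\<in>F. G \<noteq> H \<longrightarrow> \<not> digraph_iso (with_proj G) (with_proj H)) \<and>
        (\<forall>G\<in>F. cograph G \<and>
           (\<exists>l :: real. l \<notin> {0, -1} \<and>
              (\<forall>vs. vertex_ordering G vs \<longrightarrow>
                 eigenvalue (adjacency_matrix G vs) l \<and>
                 eigenvalue_multiplicity (adjacency_matrix G vs) l = dilworth_number G))))"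
proof (intro conjI allI impI exI[of _ "complete_graph ` {2..}"] ballI)
  show "eigenvalue_multiplicity (adjacency_matrix G vs) l \<le> dilworth_number G"
    if "cograph G" "vertex_ordering G vs" "l \<notin> {0, -1}" for G :: "'a pair_pre_digraph" and vs l
    using that by (intro cograph_multiplicity_le_dilworth_number) auto
next
  have "inj complete_graph" by (auto simp: inj_def complete_graph_def)
  then show "infinite (complete_graph ` {2..})"
    by (simp add: finite_image_iff inj_on_subset infinite_Ici)
next
  fix G H assume "G \<in> complete_graph ` {2..}" "H \<in> complete_graph ` {2..}" "G \<noteq> H"
  then show "\<not> digraph_iso (with_proj G) (with_proj H)"
    by (auto simp: complete_graph_def dest!: digraph_iso_card_verts)
next
  show "cograph G" if "G \<in> complete_graph ` {2..}" for G
    using that cograph_complete_graph by auto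
next
  fix G assume "G \<in> complete_graph ` {2..}"
  then obtain n where n: "2 \<le> n" and G: "G = complete_graph n" by auto
  \<comment> \<open>The family starts at 2 since \<open>n = 1\<close> would give the excluded
    eigenvalue \<open>0\<close>.\<close>
  have l: "real n - 1 \<noteq> 0" "real n - 1 \<noteq> - 1" using n by auto
  have "eigenvalue (adjacency_matrix G vs) (real n - 1) \<and>
      eigenvalue_multiplicity (adjacency_matrix G vs) (real n - 1) = dilworth_number G"
    if vs: "vertex_ordering G vs" for vs
  proof
    show ev: "eigenvalue (adjacency_matrix G vs) (real n - 1)"
      using eigenvalue_complete_graph vs n unfolding G by simp
    have "adjacency_matrix G vs \<in> carrier_mat (length vs) (length vs)"
      by (simp add: adjacency_matrix_def)
    then have "0 < eigenvalue_multiplicity (adjacency_matrix G vs) (real n - 1)"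
      using ev by (rule eigenvalue_multiplicity_pos)
    moreover have "eigenvalue_multiplicity (adjacency_matrix G vs) (real n - 1) \<le> dilworth_number G"
      using cograph_multiplicity_le_dilworth_number[OF _ vs l] cograph_complete_graph G by simp
    \<comment> \<open>The multiplicity is at least 1 and at most the Dilworth number, which is at
      most 1, so all are equal.\<close>
    ultimately show "eigenvalue_multiplicity (adjacency_matrix G vs) (real n - 1) = dilworth_number G"
      using dilworth_number_complete_graph_le[of n] G by simp
  qed
  then show "\<exists>l :: real. l \<notin> {0, -1} \<and> (\<forall>vs. vertex_ordering G vs \<longrightarrow>
      eigenvalue (adjacency_matrix G vs) l \<and>
      eigenvalue_multiplicity (adjacency_matrix G vs) l = dilworth_number G)"
    using l by (intro exI[of _ "real n - 1"]) simp
qed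

end
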